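(* Suppose the entries of $\boldsymbol{\hat\phi}$ are i.i.d. with mean $\phi$ and variance $\frac{1}{N_e^2 r}$, and that there is no noise ($v=0$), so that $\epsilon(\mathbf{g},\mathbf{H}) = \mathbb{E}\big[(\mathbf{g}^T\mathbf{H}\boldsymbol{\hat\phi}-\phi)^2\big]$. Then the global minimum error is $$\min_{\mathbf{g}\in\mathbb{R}^K,\,\mathbf{H}\in\mathbb{R}^{K\times K}}\epsilon(\mathbf{g},\mathbf{H}) = \phi^2\left(\frac{\frac{1}{N_e^2 r}}{\frac{1}{N_e^2 r}+K\phi^2}\right)=\phi^2\left(\frac{1}{1+K\phi^2N_e^2 r}\right).$$
   Context: Let $K,N_e,r\ge 1$ be integers and $\phi\in\mathbb{R}$ a fixed parameter. The random vector $\boldsymbol{\hat\phi}=(\hat\phi_1,\dots,\hat\phi_K)^T$ collects the estimates of $\phi$ from $K$ clusters; each estimate is unbiased, $\mathbb{E}[\hat\phi_i]=\phi$, with variance $\frac{1}{N_e^2 r}$. In general the final estimate is $\mathbf{g}^T(\mathbf{H}\boldsymbol{\hat\phi}+\mathbf{n})$, where $\mathbf{H}\in\mathbb{R}^{K\times K}$ (channel) and $\mathbf{g}\in\mathbb{R}^K$ (combiner) are deterministic and $\mathbf{n}$ is zero-mean Gaussian noise with independent entries of variance $v$; when $v=0$ the noise vanishes. *)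

theory Defs
  imports "HOL-Probability.Probability"
begin

definition final_estimate :: "real ^ 'k \<Rightarrow> real ^ 'k ^ 'k \<Rightarrow> real ^ 'k \<Rightarrow> real ^ 'k \<Rightarrow> real"
  where "final_estimate g H x n = g \<bullet> (H *v x + n)"

text \<open>
  The Bochner integral of a non-integrable function is 0, so this is the mean squared error only
  when the squared deviation is integrable. That is the case for square-integrable local estimates
  and square-integrable noise, whatever \<open>g\<close> and \<open>H\<close> are.
\<close>

definition est_error ::
    "'a measure \<Rightarrow> real \<Rightarrow> ('a \<Rightarrow> real ^ 'k) \<Rightarrow> ('a \<Rightarrow> real ^ 'k) \<Rightarrow> real ^ 'k \<Rightarrow> real ^ 'k ^ 'k \<Rightarrow> real"
  where "est_error M \<phi> \<phi>hat noise g H =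
    prob_space.expectation M (\<lambda>\<omega>. (final_estimate g H (\<phi>hat \<omega>) (noise \<omega>) - \<phi>)\<^sup>2)"

lemma est_error_noiseless:
  "est_error M \<phi> \<phi>hat (\<lambda>_. 0) g H = prob_space.expectation M (\<lambda>\<omega>. (g \<bullet> (H *v \<phi>hat \<omega>) - \<phi>)\<^sup>2)"
  by (simp add: est_error_def final_estimate_def)

end

(*
  Put w = g^T H. Since the estimates are uncorrelated with common mean and variance, the error is
  \<sigma>2 |w|^2 + \<phi>^2 (\<Sum>w - 1)^2. By Cauchy-Schwarz (\<Sum>w)^2 \<le> K |w|^2, with equality for constant w, so
  that it remains to minimise a quadratic polynomial in \<Sum>w.
*)
theory Submission imports Defs begin

text \<open>Expanding the square gives a double sum in which independence and centring remove every
  off-diagonal term, so only the second moments on the diagonal survive. Integrability is a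
  conclusion too, because the expectation can later be split over a sum only with it.\<close>

lemma (in prob_space) expectation_square_weighted_sum:
  fixes Y :: "'i \<Rightarrow> 'a \<Rightarrow> real"
  assumes "finite I"
    and indep: "indep_vars (\<lambda>_. borel) Y I"
    and sq: "\<And>i. i \<in> I \<Longrightarrow> integrable M (\<lambda>\<omega>. (Y i \<omega>)\<^sup>2)"
    and int: "\<And>i. i \<in> I \<Longrightarrow> integrable M (Y i)"
    and centred: "\<And>i. i \<in> I \<Longrightarrow> expectation (Y i) = 0"
  shows "integrable M (\<lambda>\<omega>. (\<Sum>i\<in>I. w i * Y i \<omega>)\<^sup>2)"
    and "expectation (\<lambda>\<omega>. (\<Sum>i\<in>I. w i * Y i \<omega>)\<^sup>2) = (\<Sum>i\<in>I. (w i)\<^sup>2 * expectation (\<lambda>\<omega>. (Y i \<omega>)\<^sup>2))"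
proof -
  \<comment> \<open>For distinct indices, a product over \<open>{i, j}\<close> is
    \<open>Y i * Y j\<close>, so the product rules for independent families apply to a single cross
    term.\<close>
  have indep2: "indep_vars (\<lambda>_. borel) Y {i, j}" if "i \<in> I" "j \<in> I" for i j
    using indep_vars_subset[OF indep] that by simp
  have int2: "integrable M (\<lambda>\<omega>. Y i \<omega> * Y j \<omega>)" if "i \<in> I" "j \<in> I" for i j
  proof (cases "i = j")
    case False
    then show ?thesis
      using indep_vars_integrable[OF _ indep2[OF that]] int that by auto
  qed (use that sq in \<open>simp add: power2_eq_square\<close>)
  have exp2: "expectation (\<lambda>\<omega>. Y i \<omega> * Y j \<omega>) = (if i = j then expectation (\<lambda>\<omega>. (Y i \<omega>)\<^sup>2) else 0)"
    if "i \<in> I" "j \<in> I" for i j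
  proof (cases "i = j")
    case False
    then show ?thesis
      using indep_vars_lebesgue_integral[OF _ indep2[OF that]] int centred that by auto
  qed (simp add: power2_eq_square)
  have expand: "(\<Sum>i\<in>I. w i * Y i \<omega>)\<^sup>2 = (\<Sum>i\<in>I. \<Sum>j\<in>I. w i * w j * (Y i \<omega> * Y j \<omega>))" for \<omega>
    by (simp add: power2_eq_square sum_product algebra_simps)
  show "integrable M (\<lambda>\<omega>. (\<Sum>i\<in>I. w i * Y i \<omega>)\<^sup>2)"
    unfolding expand using int2 by auto
  have "expectation (\<lambda>\<omega>. (\<Sum>i\<in>I. w i * Y i \<omega>)\<^sup>2)
      = (\<Sum>i\<in>I. \<Sum>j\<in>I. w i * w j * expectation (\<lambda>\<omega>. Y i \<omega> * Y j \<omega>))"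
    unfolding expand using int2 by (subst Bochner_Integration.integral_sum; auto)+
  also have "\<dots> = (\<Sum>i\<in>I. \<Sum>j\<in>I. if i = j then (w i)\<^sup>2 * expectation (\<lambda>\<omega>. (Y i \<omega>)\<^sup>2) else 0)"
    by (intro sum.cong refl) (simp add: exp2 flip: power2_eq_square)
  also have "\<dots> = (\<Sum>i\<in>I. (w i)\<^sup>2 * expectation (\<lambda>\<omega>. (Y i \<omega>)\<^sup>2))"
    using \<open>finite I\<close> by simp
  finally show "expectation (\<lambda>\<omega>. (\<Sum>i\<in>I. w i * Y i \<omega>)\<^sup>2)
      = (\<Sum>i\<in>I. (w i)\<^sup>2 * expectation (\<lambda>\<omega>. (Y i \<omega>)\<^sup>2))" .
qed

text \<open>Bias-variance decomposition: the deviation is a centred random part \<open>Z\<close>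
  plus the constant bias \<open>b\<close>. The cross term has mean 0, the variance of
  \<open>Z\<close> gives the first summand and the squared bias the second.\<close>

lemma (in prob_space) mean_square_error_linear_estimate:
  fixes X :: "'i \<Rightarrow> 'a \<Rightarrow> real"
  assumes "finite I"
    and indep: "indep_vars (\<lambda>_. borel) X I"
    and sq: "\<And>i. i \<in> I \<Longrightarrow> integrable M (\<lambda>\<omega>. (X i \<omega>)\<^sup>2)"
    and mean: "\<And>i. i \<in> I \<Longrightarrow> expectation (X i) = \<mu>"
    and var: "\<And>i. i \<in> I \<Longrightarrow> variance (X i) = v"
  shows "expectation (\<lambda>\<omega>. ((\<Sum>i\<in>I. w i * X i \<omega>) - \<mu>)\<^sup>2)
    = v * (\<Sum>i\<in>I. (w i)\<^sup>2) + \<mu>\<^sup>2 * ((\<Sum>i\<in>I. w i) - 1)\<^sup>2"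
proof -
  define Y where "Y = (\<lambda>i \<omega>. X i \<omega> - \<mu>)"
  define Z where "Z = (\<lambda>\<omega>. \<Sum>i\<in>I. w i * Y i \<omega>)"
  define b where "b = \<mu> * ((\<Sum>i\<in>I. w i) - 1)"
  \<comment> \<open>On a probability space a measurable square-integrable function is integrable;
    measurability is part of \<open>indep_vars\<close>.\<close>
  have intX: "integrable M (X i)" if "i \<in> I" for i
    using square_integrable_imp_integrable[OF _ sq[OF that]] indep that
    by (auto simp: indep_vars_def)
  have intY: "integrable M (Y i)" if "i \<in> I" for i
    using intX[OF that] by (simp add: Y_def)
  have sqY: "integrable M (\<lambda>\<omega>. (Y i \<omega>)\<^sup>2)" if "i \<in> I" for i
    using intX[OF that] sq[OF that] by (simp add: Y_def power2_diff)
  have centred: "expectation (Y i) = 0" if "i \<in> I" for i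
    using intX[OF that] mean[OF that] by (simp add: Y_def prob_space)
  have varY: "expectation (\<lambda>\<omega>. (Y i \<omega>)\<^sup>2) = v" if "i \<in> I" for i
    using var[OF that] mean[OF that] by (simp add: Y_def)
  have indepY: "indep_vars (\<lambda>_. borel) Y I"
    unfolding Y_def by (rule indep_vars_compose2[OF indep, where Y = "\<lambda>_ x. x - \<mu>"]) auto
  have sqZ: "integrable M (\<lambda>\<omega>. (Z \<omega>)\<^sup>2)"
    "expectation (\<lambda>\<omega>. (Z \<omega>)\<^sup>2) = (\<Sum>i\<in>I. (w i)\<^sup>2 * expectation (\<lambda>\<omega>. (Y i \<omega>)\<^sup>2))"
    unfolding Z_def
    by (rule expectation_square_weighted_sum[OF \<open>finite I\<close> indepY sqY intY centred]; simp)+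
  have intZ: "integrable M Z"
    unfolding Z_def using intY by auto
  have expZ: "expectation Z = 0"
    unfolding Z_def using intY centred by (subst Bochner_Integration.integral_sum) auto
  have "(\<Sum>i\<in>I. w i * X i \<omega>) - \<mu> = Z \<omega> + b" for \<omega>
    by (simp add: Z_def Y_def b_def algebra_simps sum_subtractf sum_distrib_left)
  then have "expectation (\<lambda>\<omega>. ((\<Sum>i\<in>I. w i * X i \<omega>) - \<mu>)\<^sup>2)
      = expectation (\<lambda>\<omega>. (Z \<omega>)\<^sup>2 + b\<^sup>2 + 2 * Z \<omega> * b)"
    by (simp add: power2_sum)
  also have "\<dots> = expectation (\<lambda>\<omega>. (Z \<omega>)\<^sup>2) + b\<^sup>2"
    using sqZ(1) intZ expZ by (simp add: prob_space)
  also have "expectation (\<lambda>\<omega>. (Z \<omega>)\<^sup>2) = v * (\<Sum>i\<in>I. (w i)\<^sup>2)"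
    using sqZ(2) varY by (simp add: sum_distrib_left mult.commute)
  finally show ?thesis
    by (simp add: b_def power_mult_distrib)
qed

text \<open>Here \<open>s\<close> stands for the sum of the weights and \<open>q\<close> for the sum
  of their squares. Clearing denominators leaves a multiple of the Cauchy-Schwarz gap
  \<open>K * q - s\<^sup>2\<close> plus a perfect square, both nonnegative.\<close>

lemma quadratic_lower_bound:
  fixes v m K s q :: real
  assumes "v > 0" "K > 0" "s\<^sup>2 \<le> K * q"
  shows "m\<^sup>2 * (v / (v + K * m\<^sup>2)) \<le> v * q + m\<^sup>2 * (s - 1)\<^sup>2"
proof -
  define D where "D = v + K * m\<^sup>2"
  have D: "D > 0"
    using assms by (simp add: D_def add_pos_nonneg)
  \<comment> \<open>Completing the square in \<open>s\<close>; the extra factor \<open>K\<close>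
    avoids fractions. Equality in the bound forces \<open>K * q = s\<^sup>2\<close> and
    \<open>s = K * m\<^sup>2 / D\<close>.\<close>
  have "K * (D * (v * q + m\<^sup>2 * (s - 1)\<^sup>2) - m\<^sup>2 * v) = D * v * (K * q - s\<^sup>2) + (D * s - K * m\<^sup>2)\<^sup>2"
    unfolding D_def by algebra
  also have "\<dots> \<ge> 0"
    using assms D by simp
  finally have "m\<^sup>2 * v \<le> D * (v * q + m\<^sup>2 * (s - 1)\<^sup>2)"
    using \<open>K > 0\<close> by (simp add: zero_le_mult_iff)
  with D show ?thesis
    unfolding D_def[symmetric] by (simp add: divide_le_eq mult.commute)
qed

theorem corollary3:
  fixes M :: "'a measure"
    and \<phi> :: real
    and \<phi>hat :: "'a \<Rightarrow> real ^ 'k"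
    and Ne r :: nat
  assumes "prob_space M"
    and "Ne \<ge> 1" and "r \<ge> 1"
    and indep: "prob_space.indep_vars M (\<lambda>_. borel) (\<lambda>i \<omega>. \<phi>hat \<omega> $ i) UNIV"
    and ident: "\<And>i j. distr M borel (\<lambda>\<omega>. \<phi>hat \<omega> $ i) = distr M borel (\<lambda>\<omega>. \<phi>hat \<omega> $ j)"
    and square_integrable: "\<And>i. integrable M (\<lambda>\<omega>. (\<phi>hat \<omega> $ i)\<^sup>2)"
    and mean: "\<And>i. prob_space.expectation M (\<lambda>\<omega>. \<phi>hat \<omega> $ i) = \<phi>"
    and variance: "\<And>i. prob_space.variance M (\<lambda>\<omega>. \<phi>hat \<omega> $ i) = 1 / ((real Ne)\<^sup>2 * real r)"
  defines "\<sigma>2 \<equiv> 1 / ((real Ne)\<^sup>2 * real r)"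
    and "K \<equiv> real CARD('k)"
    and "\<epsilon> \<equiv> est_error M \<phi> \<phi>hat (\<lambda>_. 0)"
  shows "(\<exists>g H. \<epsilon> g H = \<phi>\<^sup>2 * (\<sigma>2 / (\<sigma>2 + K * \<phi>\<^sup>2)))
    \<and> (\<forall>g H. \<phi>\<^sup>2 * (\<sigma>2 / (\<sigma>2 + K * \<phi>\<^sup>2)) \<le> \<epsilon> g H)
    \<and> \<phi>\<^sup>2 * (\<sigma>2 / (\<sigma>2 + K * \<phi>\<^sup>2)) = \<phi>\<^sup>2 * (1 / (1 + K * \<phi>\<^sup>2 * (real Ne)\<^sup>2 * real r))"
proof -
  interpret prob_space M by fact
  have \<sigma>2: "\<sigma>2 > 0"
    using assms(2,3) by (simp add: \<sigma>2_def)
  have K: "K > 0"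
    by (simp add: K_def)
  \<comment> \<open>The parameter \<phi> may be 0, so strict positivity has to come from
    \<open>\<sigma>2\<close>.\<close>
  have D: "\<sigma>2 + K * \<phi>\<^sup>2 > 0"
    using \<sigma>2 K by (simp add: add_pos_nonneg)
  \<comment> \<open>Moving \<open>H\<close> to the other side of the inner product shows that
    combiner and channel matter only through the weight vector \<open>g v* H\<close>.\<close>
  have err: "\<epsilon> g H = \<sigma>2 * (\<Sum>i\<in>UNIV. ((g v* H) $ i)\<^sup>2) + \<phi>\<^sup>2 * ((\<Sum>i\<in>UNIV. (g v* H) $ i) - 1)\<^sup>2"
    for g H
  proof -
    have "\<epsilon> g H = expectation (\<lambda>\<omega>. ((\<Sum>i\<in>UNIV. (g v* H) $ i * \<phi>hat \<omega> $ i) - \<phi>)\<^sup>2)"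
      by (simp add: \<epsilon>_def est_error_noiseless flip: dot_lmul_matrix)
        (simp add: inner_vec_def)
    then show ?thesis
      using mean_square_error_linear_estimate[OF finite indep square_integrable mean variance,
          of "\<lambda>i. (g v* H) $ i"]
      by (simp add: \<sigma>2_def)
  qed
  have lower: "\<phi>\<^sup>2 * (\<sigma>2 / (\<sigma>2 + K * \<phi>\<^sup>2)) \<le> \<epsilon> g H" for g H
    unfolding err
    by (rule quadratic_lower_bound[OF \<sigma>2 K])
      (use sum_squared_le_sum_of_squares[of "\<lambda>i. (g v* H) $ i" UNIV] in \<open>simp add: K_def mult.commute\<close>)
  \<comment> \<open>Equal weights make Cauchy-Schwarz tight, and this value makes their sum
    \<open>K * c\<close> the zero of the perfect square in \<open>quadratic_lower_bound\<close>.
    With the identity as channel, the combiner itself is the weight vector.\<close>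
  define c where "c = \<phi>\<^sup>2 / (\<sigma>2 + K * \<phi>\<^sup>2)"
  have "\<epsilon> (\<chi> i. c) (mat 1) = \<sigma>2 * (K * c\<^sup>2) + \<phi>\<^sup>2 * (K * c - 1)\<^sup>2"
    by (simp add: err K_def)
  also have "K * c - 1 = - \<sigma>2 / (\<sigma>2 + K * \<phi>\<^sup>2)"
    using D by (simp add: c_def field_simps)
  also have "\<sigma>2 * (K * c\<^sup>2) + \<phi>\<^sup>2 * (- \<sigma>2 / (\<sigma>2 + K * \<phi>\<^sup>2))\<^sup>2
      = \<phi>\<^sup>2 * \<sigma>2 * (\<sigma>2 + K * \<phi>\<^sup>2) / (\<sigma>2 + K * \<phi>\<^sup>2)\<^sup>2"
    \<comment> \<open>Both sides become polynomials with the inverse of the denominator as an atom,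
      so no cancellation is required here.\<close>
    unfolding c_def divide_inverse power_inverse[symmetric]
    by (simp add: power2_eq_square algebra_simps)
  also have "\<dots> = \<phi>\<^sup>2 * (\<sigma>2 / (\<sigma>2 + K * \<phi>\<^sup>2))"
    using D by (simp add: power2_eq_square)
  finally have attained: "\<epsilon> (\<chi> i. c) (mat 1) = \<phi>\<^sup>2 * (\<sigma>2 / (\<sigma>2 + K * \<phi>\<^sup>2))" .
  \<comment> \<open>Dividing numerator and denominator by \<open>\<sigma>2\<close> brings in its
    reciprocal \<open>(real Ne)\<^sup>2 * real r\<close>.\<close>
  have "\<sigma>2 / (\<sigma>2 + K * \<phi>\<^sup>2) = 1 / (1 + K * \<phi>\<^sup>2 / \<sigma>2)"
    using \<sigma>2 by (simp add: field_simps)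
  also have "\<dots> = 1 / (1 + K * \<phi>\<^sup>2 * (real Ne)\<^sup>2 * real r)"
    by (simp add: \<sigma>2_def mult.assoc)
  finally show ?thesis
    using lower attained by metis
qed

end
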